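(* Let $J_{\sup}$, $J_\infty$ and $J_r$ be the functionals on the admissible set $\mathcal A$ defined in the context, for a fixed integer $p\ge 1$, fixed numbers $N\ge 2$, $m\ge 1$, $h=1/(N-1)$, fixed sampling abscissae $c_1,\dots,c_m\in[0,1]$, and a real parameter $r\ge 1$. Then for every admissible tuple $(X,U,s,Y)\in\mathcal A$ and every $r\ge 1$, $$J_\infty(X,U,s,Y)\;\le\;J_r(X,U,s,Y)\;\le\;m^{1/r}J_\infty(X,U,s,Y)\;\le\;m^{1/r}J_{\sup}(X,U,s,Y).$$ Moreover, $J_r\to J_\infty$ pointwise on $\mathcal A$ as $r\to\infty$.
   Context: Grid: $\tau_k=(k-1)h$, $k=1,\dots,N$, $h=1/(N-1)$, on $[0,1]$. Decision variables: states $X=\{x_k\}_{k=1}^{N}$, $x_k\in\mathbb R^{n_x}$; controls $U=\{u_k\}_{k=1}^{N-1}$, $u_k\in\mathbb R^{n_u}$, applied with zero-order hold ($u(\tau)=u_k$ on $[\tau_k,\tau_{k+1})$); a time-dilation variable $s>0$; and stage variables $Y=\{Y_k\}_{k=1}^{N-1}$, $Y_k\in\mathbb R^{m n_x}$. Admissible set: for given maps $\Psi_h$ (the one-step numerical integration map), $g_d$ (path constraints) and $b_d$ (boundary constraints), $\mathcal A$ is the set of all tuples $(X,U,s,Y)$ satisfying $x_{k+1}=\Psi_h(x_k,u_k,s,Y_k)$ and $g_d(x_k,u_k,s,Y_k)\le 0$ (componentwise) for $k=1,\dots,N-1$, and $b_d(x_1,x_N,s)=0$. Local exact trajectories: let $f$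 be the vector field of the system (depending on the state and the control; fixed plant parameters are suppressed). For a tuple in $\mathcal A$ and each $k\in\{1,\dots,N-1\}$, $x(\cdot)$ on $[\tau_k,\tau_{k+1}]$ denotes the solution of $\dot x(\tau)=s\,f(x(\tau),u_k)$, $x(\tau_k)=x_k$ (so the local trajectory on each interval is restarted from $x_k$). Standing assumption: for each such interval this initial value problem has a unique solution, which is $(p+1)$-times continuously differentiable in $\tau$ with $\sup_{\tau\in[\tau_k,\tau_{k+1}]}\|x^{(p+1)}(\tau)\|<\infty$, where $x^{(p+1)}$ is the $(p+1)$-st derivative and $\|\cdot\|$ is a norm on $\mathbb R^{n_x}$. Sampling points: $\tau_{k,i}:=\tau_k+c_i h$, $i=1,\dots,m$, and $a^{(p)}_{k,i}(x_k,u_k,s):=\|x^{(p+1)}(\tau_{k,i})\|$, evaluated on the local trajectory on $[\tau_k,\tau_{k+1}]$. Functionals: $$J_{\sup}(X,U,s,Y):=\sum_{k=1}^{N-1}\ \sup_{\tau\in[\tau_k,\tau_{k+1}]}\|x^{(p+1)}(\tau)\|,$$ $$J_\infty(X,U,s,Y):=\sum_{k=1}^{N-1}\ \max_{i=1,\dots,m}a^{(p)}_{k,i}(x_k,u_k,s),$$ $$J_r(X,U,s,Y):=\sum_{k=1}^{N-1}\Big(\sum_{i=1}^m a^{(p)}_{k,i}(x_k,u_k,s)^r\Big)^{1/r}.$$ *)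

theory Defs
  imports "HOL-Analysis.Analysis"
begin

text \<open>
  A decision tuple \<open>(X, U, s, Y)\<close>.  The index types \<open>'n\<close>, \<open>'u\<close>, \<open>'m\<close> carry the dimensions
  \<open>n\<^sub>x = CARD('n)\<close>, \<open>n\<^sub>u = CARD('u)\<close> and the number of stages \<open>m = CARD('m)\<close>.  The families are
  indexed by naturals starting at 1; only \<open>X 1, \<dots>, X N\<close> and \<open>U k\<close>, \<open>Y k\<close> with
  \<open>1 \<le> k \<le> N - 1\<close> are ever used.
\<close>

type_synonym ('n, 'u, 'm) tuple =
  "(nat \<Rightarrow> real ^ 'n) \<times> (nat \<Rightarrow> real ^ 'u) \<times> real \<times> (nat \<Rightarrow> real ^ ('m \<times> 'n))"

definition step :: "nat \<Rightarrow> real" where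
  "step N = 1 / (real N - 1)"

definition grid :: "nat \<Rightarrow> nat \<Rightarrow> real" where
  "grid N k = (real k - 1) * step N"

definition cell :: "nat \<Rightarrow> nat \<Rightarrow> real set" where
  "cell N k = {grid N k .. grid N (k + 1)}"

definition admissible ::
  "nat \<Rightarrow> (real ^ 'n \<Rightarrow> real ^ 'u \<Rightarrow> real \<Rightarrow> real ^ ('m \<times> 'n) \<Rightarrow> real ^ 'n)
    \<Rightarrow> (real ^ 'n \<Rightarrow> real ^ 'u \<Rightarrow> real \<Rightarrow> real ^ ('m \<times> 'n) \<Rightarrow> real ^ 'g)
    \<Rightarrow> (real ^ 'n \<Rightarrow> real ^ 'n \<Rightarrow> real \<Rightarrow> real ^ 'b)
    \<Rightarrow> ('n :: finite, 'u :: finite, 'm :: finite) tuple set" where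
  "admissible N \<Psi> g b = {(X, U, s, Y).
     s > 0 \<and>
     (\<forall>k\<in>{1..N-1}. X (k + 1) = \<Psi> (X k) (U k) s (Y k)) \<and>
     (\<forall>k\<in>{1..N-1}. \<forall>i. g (X k) (U k) s (Y k) $ i \<le> 0) \<and>
     b (X 1) (X N) s = 0}"

definition is_norm :: "('a :: real_vector \<Rightarrow> real) \<Rightarrow> bool" where
  "is_norm \<nu> \<longleftrightarrow>
     (\<forall>x. 0 \<le> \<nu> x) \<and> (\<forall>x. \<nu> x = 0 \<longleftrightarrow> x = 0) \<and>
     (\<forall>a x. \<nu> (a *\<^sub>R x) = \<bar>a\<bar> * \<nu> x) \<and>
     (\<forall>x y. \<nu> (x + y) \<le> \<nu> x + \<nu> y)"

text \<open>
  Iterated derivatives relative to \<open>S\<close>: one-sided at the end points when \<open>S\<close> is a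
  nondegenerate compact interval.
\<close>

primrec nth_derivative :: "nat \<Rightarrow> real set \<Rightarrow> (real \<Rightarrow> 'a :: real_normed_vector) \<Rightarrow> real \<Rightarrow> 'a" where
  "nth_derivative 0 S x = x"
| "nth_derivative (Suc j) S x = (\<lambda>t. vector_derivative (nth_derivative j S x) (at t within S))"

definition cont_differentiable_on ::
  "nat \<Rightarrow> (real \<Rightarrow> 'a :: real_normed_vector) \<Rightarrow> real set \<Rightarrow> bool" where
  "cont_differentiable_on q x S \<longleftrightarrow>
     (\<forall>j<q. nth_derivative j S x differentiable_on S) \<and>
     continuous_on S (nth_derivative q S x)"

text \<open>
  Solutions of \<open>x' = s f(x, u)\<close>, \<open>x(\<tau>\<^sub>k) = x\<^sub>0\<close> on \<open>[\<tau>\<^sub>k, \<tau>\<^sub>k\<^sub>+\<^sub>1]\<close>.  A function on this interval is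
  a function on the reals that is \<open>undefined\<close> elsewhere, so that uniqueness of the
  solution can be expressed by \<open>\<exists>!\<close>.
\<close>

definition is_local_trajectory ::
  "(real ^ 'n \<Rightarrow> real ^ 'u \<Rightarrow> real ^ 'n) \<Rightarrow> nat \<Rightarrow> nat \<Rightarrow> real ^ 'n \<Rightarrow> real ^ 'u \<Rightarrow> real
    \<Rightarrow> (real \<Rightarrow> real ^ ('n :: finite)) \<Rightarrow> bool" where
  "is_local_trajectory f N k x0 u s x \<longleftrightarrow>
     x \<in> extensional (cell N k) \<and>
     x (grid N k) = x0 \<and>
     (\<forall>t\<in>cell N k. (x has_vector_derivative s *\<^sub>R f (x t) u) (at t within cell N k))"

definition local_trajectory ::
  "(real ^ 'n \<Rightarrow> real ^ 'u \<Rightarrow> real ^ 'n) \<Rightarrow> nat \<Rightarrow> nat \<Rightarrow> real ^ 'n \<Rightarrow> real ^ 'u \<Rightarrow> real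
    \<Rightarrow> real \<Rightarrow> real ^ ('n :: finite)" where
  "local_trajectory f N k x0 u s = (THE x. is_local_trajectory f N k x0 u s x)"

definition deriv_norm ::
  "(real ^ 'n \<Rightarrow> real) \<Rightarrow> (real ^ 'n \<Rightarrow> real ^ 'u \<Rightarrow> real ^ 'n) \<Rightarrow> nat \<Rightarrow> nat \<Rightarrow> nat
    \<Rightarrow> real ^ ('n :: finite) \<Rightarrow> real ^ 'u \<Rightarrow> real \<Rightarrow> real \<Rightarrow> real" where
  "deriv_norm \<nu> f N p k x0 u s t =
     \<nu> (nth_derivative (p + 1) (cell N k) (local_trajectory f N k x0 u s) t)"

definition sample ::
  "(real ^ 'n \<Rightarrow> real) \<Rightarrow> (real ^ 'n \<Rightarrow> real ^ 'u \<Rightarrow> real ^ 'n) \<Rightarrow> nat \<Rightarrow> nat \<Rightarrow> real ^ 'm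
    \<Rightarrow> nat \<Rightarrow> 'm \<Rightarrow> real ^ ('n :: finite) \<Rightarrow> real ^ 'u \<Rightarrow> real \<Rightarrow> real" where
  "sample \<nu> f N p c k i x0 u s = deriv_norm \<nu> f N p k x0 u s (grid N k + c $ i * step N)"

definition J_sup ::
  "(real ^ 'n \<Rightarrow> real) \<Rightarrow> (real ^ 'n \<Rightarrow> real ^ 'u \<Rightarrow> real ^ 'n) \<Rightarrow> nat \<Rightarrow> nat
    \<Rightarrow> ('n :: finite, 'u, 'm) tuple \<Rightarrow> real" where
  "J_sup \<nu> f N p = (\<lambda>(X, U, s, Y).
     \<Sum>k=1..N-1. SUP t\<in>cell N k. deriv_norm \<nu> f N p k (X k) (U k) s t)"

definition J_inf ::
  "(real ^ 'n \<Rightarrow> real) \<Rightarrow> (real ^ 'n \<Rightarrow> real ^ 'u \<Rightarrow> real ^ 'n) \<Rightarrow> nat \<Rightarrow> nat \<Rightarrow> real ^ 'm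
    \<Rightarrow> ('n :: finite, 'u, 'm :: finite) tuple \<Rightarrow> real" where
  "J_inf \<nu> f N p c = (\<lambda>(X, U, s, Y).
     \<Sum>k=1..N-1. MAX i. sample \<nu> f N p c k i (X k) (U k) s)"

definition J ::
  "real \<Rightarrow> (real ^ 'n \<Rightarrow> real) \<Rightarrow> (real ^ 'n \<Rightarrow> real ^ 'u \<Rightarrow> real ^ 'n) \<Rightarrow> nat \<Rightarrow> nat \<Rightarrow> real ^ 'm
    \<Rightarrow> ('n :: finite, 'u, 'm :: finite) tuple \<Rightarrow> real" where
  "J r \<nu> f N p c = (\<lambda>(X, U, s, Y).
     \<Sum>k=1..N-1. (\<Sum>i\<in>UNIV. sample \<nu> f N p c k i (X k) (U k) s powr r) powr (1 / r))"

end

theory Submission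
  imports Defs
begin

text \<open>
  On each grid cell the three functionals compare the maximum of the finitely many samples, their
  \<open>\<ell>\<^sup>r\<close> norm, and the supremum over the whole cell.  For nonnegative \<open>a\<^sub>i\<close>, \<open>i \<in> I\<close>, with maximum
  \<open>M\<close>, the sum \<open>\<Sum>\<^sub>i a\<^sub>i\<^sup>r\<close> contains the term \<open>M\<^sup>r\<close> and has \<open>card I\<close> terms, none exceeding \<open>M\<^sup>r\<close>;
  taking \<open>r\<close>-th roots gives \<open>M \<le> (\<Sum>\<^sub>i a\<^sub>i\<^sup>r)\<^bsup>1/r\<^esup> \<le> (card I)\<^bsup>1/r\<^esup> M\<close> (lemmas \<open>Max_le_power_norm\<close>
  and \<open>power_norm_le_Max\<close>).  Every sampling point lies in its cell because \<open>c\<^sub>i \<in> [0, 1]\<close>, so a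
  sample is at most the supremum over the cell, which is a genuine least upper bound thanks to the
  boundedness of the \<open>(p+1)\<close>-st derivative.  Summing over the cells yields the three inequalities.

  Since \<open>(card I)\<^bsup>1/r\<^esup> \<rightarrow> 1\<close> as \<open>r \<rightarrow> \<infinity>\<close>, the first two inequalities squeeze \<open>J\<^sub>r\<close> to \<open>J\<^sub>\<infinity>\<close>.
\<close>

lemma Max_le_power_norm:
  fixes a :: "'i \<Rightarrow> real"
  assumes "finite I" "I \<noteq> {}" "\<And>i. i \<in> I \<Longrightarrow> 0 \<le> a i" "r > 0"
  shows "Max (a ` I) \<le> (\<Sum>i\<in>I. a i powr r) powr (1 / r)"
proof (rule Max.boundedI)
  fix y assume "y \<in> a ` I"
  then obtain i where i: "i \<in> I" "y = a i" by blast
  have "y = (a i powr r) powr (1 / r)"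
    using i assms by (simp add: powr_powr)
  also have "\<dots> \<le> (\<Sum>j\<in>I. a j powr r) powr (1 / r)"
    using i assms by (intro powr_mono2 member_le_sum) auto
  finally show "y \<le> (\<Sum>j\<in>I. a j powr r) powr (1 / r)" .
qed (use assms in auto)

lemma power_norm_le_Max:
  fixes a :: "'i \<Rightarrow> real"
  assumes "finite I" "I \<noteq> {}" "\<And>i. i \<in> I \<Longrightarrow> 0 \<le> a i" "r > 0"
  shows "(\<Sum>i\<in>I. a i powr r) powr (1 / r) \<le> real (card I) powr (1 / r) * Max (a ` I)"
proof -
  let ?M = "Max (a ` I)"
  have le_M: "a i \<le> ?M" if "i \<in> I" for i
    using assms that by simp
  have M_nonneg: "0 \<le> ?M"
    using assms le_M by (meson ex_in_conv order_trans)
  have "(\<Sum>i\<in>I. a i powr r) \<le> real (card I) * ?M powr r"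
    using assms le_M by (intro sum_bounded_above powr_mono2) auto
  then have "(\<Sum>i\<in>I. a i powr r) powr (1 / r) \<le> (real (card I) * ?M powr r) powr (1 / r)"
    using assms by (intro powr_mono2 sum_nonneg) auto
  also have "\<dots> = real (card I) powr (1 / r) * ?M"
    using assms M_nonneg by (simp add: powr_mult powr_powr)
  finally show ?thesis .
qed

lemma sampling_point_in_cell:
  assumes "N \<ge> 2" "\<gamma> \<in> {0..1}"
  shows "grid N k + \<gamma> * step N \<in> cell N k"
proof -
  have "0 \<le> step N"
    using assms by (simp add: step_def)
  moreover have "grid N (k + 1) = grid N k + step N"
    by (simp add: grid_def algebra_simps)
  ultimately show ?thesis
    using assms by (simp add: cell_def mult_left_le_one_le)
qed

lemma sample_nonneg: "is_norm \<nu> \<Longrightarrow> 0 \<le> sample \<nu> f N p c k i x0 u s"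
  by (simp add: is_norm_def sample_def deriv_norm_def)

lemma J_inf_le_J:
  assumes "is_norm \<nu>" "r > 0"
  shows "J_inf \<nu> f N p c z \<le> J r \<nu> f N p c z"
  unfolding J_inf_def J_def using assms
  by (auto split: prod.split intro!: sum_mono Max_le_power_norm sample_nonneg)

lemma J_le_J_inf:
  fixes c :: "real ^ 'm::finite"
  assumes "is_norm \<nu>" "r > 0"
  shows "J r \<nu> f N p c z \<le> real CARD('m) powr (1 / r) * J_inf \<nu> f N p c z"
  unfolding J_inf_def J_def using assms
  by (auto split: prod.split simp: sum_distrib_left
      intro!: sum_mono power_norm_le_Max sample_nonneg)

theorem proposition2:
  fixes N p :: nat
    and c :: "real ^ 'm::finite"
    and \<nu> :: "real ^ 'n::finite \<Rightarrow> real"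
    and f :: "real ^ 'n \<Rightarrow> real ^ 'u::finite \<Rightarrow> real ^ 'n"
    and \<Psi> :: "real ^ 'n \<Rightarrow> real ^ 'u \<Rightarrow> real \<Rightarrow> real ^ ('m \<times> 'n) \<Rightarrow> real ^ 'n"
    and g :: "real ^ 'n \<Rightarrow> real ^ 'u \<Rightarrow> real \<Rightarrow> real ^ ('m \<times> 'n) \<Rightarrow> real ^ 'g::finite"
    and b :: "real ^ 'n \<Rightarrow> real ^ 'n \<Rightarrow> real \<Rightarrow> real ^ 'b::finite"
  assumes "p \<ge> 1" and "N \<ge> 2"
    and "\<forall>i. c $ i \<in> {0..1}"
    and "is_norm \<nu>"
    and "\<forall>(X, U, s, Y)\<in>admissible N \<Psi> g b. \<forall>k\<in>{1..N-1}.
           (\<exists>!x. is_local_trajectory f N k (X k) (U k) s x) \<and>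
           cont_differentiable_on (p + 1) (local_trajectory f N k (X k) (U k) s) (cell N k) \<and>
           bdd_above (deriv_norm \<nu> f N p k (X k) (U k) s ` cell N k)"
  shows "(\<forall>z\<in>admissible N \<Psi> g b. \<forall>r::real. r \<ge> 1 \<longrightarrow>
            J_inf \<nu> f N p c z \<le> J r \<nu> f N p c z \<and>
            J r \<nu> f N p c z \<le> real CARD('m) powr (1 / r) * J_inf \<nu> f N p c z \<and>
            real CARD('m) powr (1 / r) * J_inf \<nu> f N p c z
              \<le> real CARD('m) powr (1 / r) * J_sup \<nu> f N p z) \<and>
         (\<forall>z\<in>admissible N \<Psi> g b. ((\<lambda>r. J r \<nu> f N p c z) \<longlongrightarrow> J_inf \<nu> f N p c z) at_top)"
proof (intro conjI ballI allI impI)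
  fix z :: "('n, 'u, 'm) tuple" and r :: real
  assume "z \<in> admissible N \<Psi> g b" and r: "r \<ge> 1"
  show "J_inf \<nu> f N p c z \<le> J r \<nu> f N p c z"
    using r by (intro J_inf_le_J[OF \<open>is_norm \<nu>\<close>]) simp
  show "J r \<nu> f N p c z \<le> real CARD('m) powr (1 / r) * J_inf \<nu> f N p c z"
    using r by (intro J_le_J_inf[OF \<open>is_norm \<nu>\<close>]) simp
  obtain X U s Y where z: "z = (X, U, s, Y)"
    by (cases z)
  have "J_inf \<nu> f N p c z \<le> J_sup \<nu> f N p z"
    unfolding J_inf_def J_sup_def z prod.case
  proof (rule sum_mono)
    fix k assume "k \<in> {1..N - 1}"
    then have bdd: "bdd_above (deriv_norm \<nu> f N p k (X k) (U k) s ` cell N k)"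
      using assms(5) \<open>z \<in> admissible N \<Psi> g b\<close> z by fastforce
    show "(MAX i. sample \<nu> f N p c k i (X k) (U k) s)
        \<le> (SUP t\<in>cell N k. deriv_norm \<nu> f N p k (X k) (U k) s t)"
      unfolding sample_def using assms(2,3) bdd
      by (auto intro!: cSUP_upper sampling_point_in_cell)
  qed
  then show "real CARD('m) powr (1 / r) * J_inf \<nu> f N p c z
      \<le> real CARD('m) powr (1 / r) * J_sup \<nu> f N p z"
    by (simp add: mult_left_mono)
next
  fix z :: "('n, 'u, 'm) tuple"
  have "((\<lambda>r. real CARD('m) powr (1 / r)) \<longlongrightarrow> real CARD('m) powr 0) at_top"
    by (intro tendsto_powr tendsto_const tendsto_divide_0[OF tendsto_const]
        filterlim_at_top_imp_at_infinity filterlim_ident) simp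
  then have upper: "((\<lambda>r. real CARD('m) powr (1 / r) * J_inf \<nu> f N p c z)
      \<longlongrightarrow> J_inf \<nu> f N p c z) at_top"
    by (auto dest: tendsto_mult_right[where c = "J_inf \<nu> f N p c z"])
  show "((\<lambda>r. J r \<nu> f N p c z) \<longlongrightarrow> J_inf \<nu> f N p c z) at_top"
  proof (rule tendsto_sandwich[OF _ _ tendsto_const upper])
    show "\<forall>\<^sub>F r in at_top. J_inf \<nu> f N p c z \<le> J r \<nu> f N p c z"
      using eventually_gt_at_top[of 0]
      by eventually_elim (rule J_inf_le_J[OF \<open>is_norm \<nu>\<close>])
    show "\<forall>\<^sub>F r in at_top. J r \<nu> f N p c z \<le> real CARD('m) powr (1 / r) * J_inf \<nu> f N p c z"
      using eventually_gt_at_top[of 0]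
      by eventually_elim (rule J_le_J_inf[OF \<open>is_norm \<nu>\<close>])
  qed
qed

end
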